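(* Let $(a_n)_{n\ge1}$ be a sequence of real or complex numbers and let $(X_n)_{n\ge1}$ be a sequence of real or complex random variables in $L^2(\Omega)$ for some probability space $\Omega$, with covariance matrix $(\gamma(n,m))_{n,m\ge1}$, where $\gamma(n,m)=\mathbb{E}(X_n\overline{X_m})$. Assume that there exists $b\ge0$ such that the linear operator on $\ell^2(\mathbb{N})$ defined by the matrix $(\beta_{n,m})_{n,m\geq 1}$ with $$\beta_{n,m}=|\gamma(n,m)|\,n^{-b}m^{-b}$$ is bounded. If $$\sum_{n=1}^\infty|a_n|^2n^{2b}\log_2^2(n+1)<\infty,$$ then the series $\sum_{n=1}^\infty a_nX_n$ converges almost surely.
   Context: $\log_2$ denotes the base-2 logarithm and $\log_2^2(x)=(\log_2 x)^2$. Here $\mathbb{N}=\{1,2,3,\dots\}$. The term "covariance matrix" means the matrix of the $L^2(\Omega)$ inner products $\langle X_n,X_m\rangle=\mathbb{E}(X_n\overline{X_m})$. *)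

theory Defs
  imports "HOL-Probability.Probability"
begin

text \<open>
  The space \<open>\<ell>\<^sup>2(I)\<close> of complex families over an index set \<open>I\<close>. Families are total functions
  whose values outside \<open>I\<close> are irrelevant; \<open>I = {1..}\<close> gives sequences indexed from \<open>1\<close>.
\<close>

definition ell2 :: "'i set \<Rightarrow> ('i \<Rightarrow> complex) set" where
  "ell2 I = {x. (\<lambda>i. (cmod (x i))\<^sup>2) summable_on I}"

definition ell2_norm :: "'i set \<Rightarrow> ('i \<Rightarrow> complex) \<Rightarrow> real" where
  "ell2_norm I x = sqrt (\<Sum>\<^sub>\<infinity>i\<in>I. (cmod (x i))\<^sup>2)"

definition matrix_op :: "'i set \<Rightarrow> ('i \<Rightarrow> 'i \<Rightarrow> complex) \<Rightarrow> ('i \<Rightarrow> complex) \<Rightarrow> 'i \<Rightarrow> complex" where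
  "matrix_op I A x = (\<lambda>i. \<Sum>\<^sub>\<infinity>j\<in>I. A i j * x j)"

text \<open>
  Since \<open>infsum\<close> is \<open>0\<close> for non-summable families, convergence of the row sums is required
  explicitly, as is that the operator maps \<open>\<ell>\<^sup>2(I)\<close> into itself. Unconditional summability of
  the row sums for all \<open>x\<close> in \<open>\<ell>\<^sup>2(I)\<close> is no stronger than convergence as ordinary series:
  \<open>\<ell>\<^sup>2(I)\<close> is closed under changing the phases of the coordinates.
\<close>

definition bounded_matrix_op :: "'i set \<Rightarrow> ('i \<Rightarrow> 'i \<Rightarrow> complex) \<Rightarrow> bool" where
  "bounded_matrix_op I A \<longleftrightarrow>
     (\<forall>x\<in>ell2 I. (\<forall>i\<in>I. (\<lambda>j. A i j * x j) summable_on I) \<and> matrix_op I A x \<in> ell2 I) \<and>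
     (\<exists>C. \<forall>x\<in>ell2 I. ell2_norm I (matrix_op I A x) \<le> C * ell2_norm I x)"

text \<open>No centering: this is the Gram matrix of the \<open>L\<^sup>2\<close> inner products.\<close>

definition covariance_matrix ::
  "'w measure \<Rightarrow> (nat \<Rightarrow> 'w \<Rightarrow> complex) \<Rightarrow> nat \<Rightarrow> nat \<Rightarrow> complex" where
  "covariance_matrix M X n m = (LINT w|M. X n w * cnj (X m w))"

end

theory Submission
  imports Defs "HOL-Library.Discrete_Functions"
begin

text \<open>
  The theorem is a form of the Rademacher--Menshov theorem, in which orthogonality is replaced by
  the weaker second-moment bound
  \<open>E \<bar>\<Sum>n\<in>J. a\<^sub>n X\<^sub>n\<bar>\<^sup>2 \<le> C (\<Sum>n\<in>J. w\<^sub>n)\<close> with \<open>w\<^sub>n = \<bar>a\<^sub>n\<bar>\<^sup>2 n\<^bsup>2b\<^esup>\<close>.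
  To get this bound, expand the square and replace every term by its modulus; writing
  \<open>x\<^sub>n = \<bar>a\<^sub>n\<bar> n\<^bsup>b\<^esup>\<close>, what results is the quadratic form of \<open>\<beta>\<close> at \<open>x\<close>, and a bounded operator has a
  bounded quadratic form (\<open>bounded_matrix_op_quadratic_form\<close>, \<open>second_moment_sum_le\<close>).

  The convergence statement \<open>AE_convergent_of_second_moment_bound\<close> rests on dyadic chaining.
  Cut the indices into the blocks \<open>[2\<^sup>k, 2\<^sup>k\<^sup>+\<^sup>1)\<close>. A partial sum inside block \<open>k\<close> is a sum of at
  most one dyadic piece of each length \<open>2\<^sup>0, \<dots>, 2\<^sup>k\<close>, so its square is at most \<open>k + 1\<close> times the
  energy \<open>Q\<^sub>k\<close>, the sum of the squares of all dyadic pieces of the block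
  (\<open>norm_partial_sum_le_dyadic_energy\<close>). Each of the \<open>k + 1\<close> scales contributes at most \<open>C W\<^sub>k\<close> to
  \<open>E Q\<^sub>k\<close>, where \<open>W\<^sub>k\<close> is the sum of \<open>w\<close> over the block. Hence \<open>E ((k+1) Q\<^sub>k) \<le> C (k+1)\<^sup>2 W\<^sub>k\<close>, which
  is summable because \<open>k + 1 \<le> 2 log\<^sub>2 (n+1)\<close> on the block: this is where the squared logarithm comes
  from. So almost surely the oscillation within block \<open>k\<close> tends to \<open>0\<close>. The full block sums \<open>D\<^sub>k\<close>
  satisfy \<open>\<Sum>k. (k+1)\<^sup>2 \<bar>D\<^sub>k\<bar>\<^sup>2 < \<infinity>\<close> almost surely for the same reason, and so are absolutely summable by
  Cauchy--Schwarz against \<open>1/(k+1)\<close>.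
\<close>

section \<open>Dyadic chaining\<close>

text \<open>
  Unfolded, this is the sum of \<open>(norm (\<Sum>i\<in>J. u i))\<^sup>2\<close> over all intervals \<open>J\<close> that arise from
  \<open>{p..<p + 2 ^ k}\<close> by repeated halving, down to length \<open>1\<close>.
\<close>

fun dyadic_energy :: "(nat \<Rightarrow> 'a::real_normed_vector) \<Rightarrow> nat \<Rightarrow> nat \<Rightarrow> real" where
  "dyadic_energy u 0 p = (norm (u p))\<^sup>2"
| "dyadic_energy u (Suc k) p =
     (norm (\<Sum>i=p..<p + 2 ^ Suc k. u i))\<^sup>2 + dyadic_energy u k p + dyadic_energy u k (p + 2 ^ k)"

lemma dyadic_energy_nonneg: "dyadic_energy u k p \<ge> 0"
  by (induction k arbitrary: p) auto

lemma block_sum_le_dyadic_energy: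
  "(norm (\<Sum>i=p..<p + 2 ^ k. u i))\<^sup>2 \<le> dyadic_energy u k p"
  by (cases k) (auto intro: add_nonneg_nonneg dyadic_energy_nonneg)

text \<open>Cauchy--Schwarz for two terms with weights \<open>1\<close> and \<open>t\<close>.\<close>

lemma norm_add_squared_le_weighted:
  fixes x y :: "'a::real_normed_vector"
  assumes "t > 0"
  shows "(norm (x + y))\<^sup>2 \<le> (1 + t) * ((norm x)\<^sup>2 + (norm y)\<^sup>2 / t)"
proof -
  have "(norm (x + y))\<^sup>2 \<le> (norm x + norm y)\<^sup>2"
    by (intro power_mono norm_triangle_ineq) auto
  also have "\<dots> \<le> (norm x + norm y)\<^sup>2 + (t * norm x - norm y)\<^sup>2 / t"
    using assms by simp
  also have "\<dots> = (1 + t) * ((norm x)\<^sup>2 + (norm y)\<^sup>2 / t)"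
    using assms by (simp add: field_simps power2_eq_square)
  finally show ?thesis .
qed

text \<open>
  The chaining bound, by bisection: an initial segment longer than half the block is the left half
  followed by an initial segment of the right half. The weight \<open>t = k + 1\<close> compensates exactly the
  factor \<open>k + 1\<close> in the bound for that second segment, so each bisection costs only \<open>1\<close> in the
  factor.
\<close>

lemma norm_partial_sum_le_dyadic_energy:
  fixes u :: "nat \<Rightarrow> 'a::real_normed_vector"
  assumes "j \<le> 2 ^ k"
  shows "(norm (\<Sum>i=p..<p + j. u i))\<^sup>2 \<le> (real k + 1) * dyadic_energy u k p"
  using assms
proof (induction k arbitrary: p j)
  case 0
  then have "j = 0 \<or> j = 1" by auto
  then show ?case by auto
next
  case (Suc k)
  let ?Q = "dyadic_energy u k p" and ?Q' = "dyadic_energy u k (p + 2 ^ k)"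
  have nn: "?Q \<ge> 0" "?Q' \<ge> 0" by (auto intro: dyadic_energy_nonneg)
  have le: "?Q + ?Q' \<le> dyadic_energy u (Suc k) p" by simp
  show ?case
  proof (cases "j \<le> 2 ^ k")
    case True
    then have "(norm (\<Sum>i=p..<p + j. u i))\<^sup>2 \<le> (real k + 1) * ?Q" by (rule Suc.IH)
    also have "\<dots> \<le> (real (Suc k) + 1) * dyadic_energy u (Suc k) p"
      using nn le by (intro mult_mono) auto
    finally show ?thesis .
  next
    case False
    define i where "i = j - 2 ^ k"
    have i: "i \<le> 2 ^ k" "j = 2 ^ k + i" using False Suc.prems by (auto simp: i_def)
    let ?A = "\<Sum>i=p..<p + 2 ^ k. u i"
    let ?B = "\<Sum>l=p + 2 ^ k..<p + 2 ^ k + i. u l"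
    have "(\<Sum>i=p..<p + j. u i) = ?A + ?B"
      unfolding i(2) by (subst sum.atLeastLessThan_concat) (auto simp: add.assoc)
    then have "(norm (\<Sum>i=p..<p + j. u i))\<^sup>2 \<le>
        (1 + (real k + 1)) * ((norm ?A)\<^sup>2 + (norm ?B)\<^sup>2 / (real k + 1))"
      by (simp only:) (rule norm_add_squared_le_weighted, simp)
    also have "\<dots> \<le> (1 + (real k + 1)) * (?Q + ?Q')"
    proof -
      have "(norm ?B)\<^sup>2 / (real k + 1) \<le> ?Q'"
        using Suc.IH[OF i(1), of "p + 2 ^ k"] by (simp add: divide_le_eq mult.commute)
      then show ?thesis
        using block_sum_le_dyadic_energy[where u = u] by (intro mult_left_mono add_mono) auto
    qed
    also have "\<dots> \<le> (real (Suc k) + 1) * dyadic_energy u (Suc k) p"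
      using nn le by (intro mult_mono) auto
    finally show ?thesis .
  qed
qed

text \<open>
  Absolute summability of the block sums lets the partial sums along \<open>2 ^ k - 1\<close> converge;
  chaining shows that within a block the partial sums stay close to these.
\<close>

lemma convergent_if_dyadic_energy_summable:
  fixes u :: "nat \<Rightarrow> 'a::banach"
  assumes blocks: "summable (\<lambda>k. (real k + 1)\<^sup>2 * (norm (\<Sum>i=2 ^ k..<2 ^ k + 2 ^ k. u i))\<^sup>2)"
    and energy: "summable (\<lambda>k. (real k + 1) * dyadic_energy u k (2 ^ k))"
  shows "convergent (\<lambda>N. \<Sum>n=1..N. u n)"
proof -
  define D where "D k = (\<Sum>i=2 ^ k..<2 ^ k + 2 ^ k. u i)" for k :: nat
  define g where "g k = (real k + 1) * dyadic_energy u k (2 ^ k)" for k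
  \<comment> \<open>Summability of \<open>D\<close>: the inequality \<open>2xy \<le> x\<^sup>2 + y\<^sup>2\<close> with \<open>x = (k+1) \<bar>D\<^sub>k\<bar>\<close> and \<open>y = 1/(k+1)\<close>.\<close>
  have "summable (\<lambda>k. norm (D k))"
  proof (rule summable_comparison_test')
    have "summable (\<lambda>k. 1 / (real (Suc k))\<^sup>2)"
      using inverse_power_summable[of 2, where 'a = real]
      by (subst summable_Suc_iff) (simp add: inverse_eq_divide)
    then have "summable (\<lambda>k. 1 / (real k + 1)\<^sup>2)"
      by (simp add: add.commute)
    with blocks show "summable (\<lambda>k. (real k + 1)\<^sup>2 * (norm (D k))\<^sup>2 + 1 / (real k + 1)\<^sup>2)"
      unfolding D_def by (rule summable_add)
    show "norm (norm (D k)) \<le> (real k + 1)\<^sup>2 * (norm (D k))\<^sup>2 + 1 / (real k + 1)\<^sup>2" for k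
    proof -
      have "2 * ((real k + 1) * norm (D k)) * (1 / (real k + 1))
          \<le> ((real k + 1) * norm (D k))\<^sup>2 + (1 / (real k + 1))\<^sup>2"
        by (rule sum_squares_bound)
      moreover have "2 * ((real k + 1) * norm (D k)) * (1 / (real k + 1)) = 2 * norm (D k)"
        by simp
      ultimately show ?thesis
        by (simp add: power_mult_distrib power_divide) (smt (verit) norm_ge_zero)
    qed
  qed
  then have "summable D" by (rule summable_norm_cancel)
  then obtain L where L: "(\<lambda>K. \<Sum>k<K. D k) \<longlonglongrightarrow> L"
    by (auto simp: summable_def sums_def)
  have dyadic: "(\<Sum>k<K. D k) = (\<Sum>n=1..<2 ^ K. u n)" for K
    by (induction K) (simp_all add: D_def sum.atLeastLessThan_concat mult_2)
  have fl: "filterlim floor_log at_top sequentially"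
    unfolding filterlim_at_top
  proof
    fix Z
    show "\<forall>\<^sub>F N in sequentially. Z \<le> floor_log N"
      using eventually_ge_at_top[of "2 ^ Z"]
      by eventually_elim (metis floor_log_power floor_log_le_iff)
  qed
  have "g \<longlonglongrightarrow> 0" using summable_LIMSEQ_zero[OF energy] unfolding g_def[abs_def] .
  then have g0: "(\<lambda>N. sqrt (g (floor_log N))) \<longlonglongrightarrow> 0"
    using tendsto_real_sqrt[OF filterlim_compose[OF _ fl]] by fastforce
  have P: "(\<lambda>N. \<Sum>n=1..<2 ^ floor_log N. u n) \<longlonglongrightarrow> L"
    using filterlim_compose[OF L fl] by (simp add: dyadic)
  have "(\<lambda>N. (\<Sum>n=1..N. u n) - (\<Sum>n=1..<2 ^ floor_log N. u n)) \<longlonglongrightarrow> 0"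
  proof (rule Lim_null_comparison[OF _ g0])
    show "\<forall>\<^sub>F N in sequentially.
        norm ((\<Sum>n=1..N. u n) - (\<Sum>n=1..<2 ^ floor_log N. u n)) \<le> sqrt (g (floor_log N))"
      using eventually_gt_at_top[of 0]
    proof eventually_elim
      case (elim N)
      let ?k = "floor_log N"
      define j where "j = Suc N - 2 ^ ?k"
      have lo: "2 ^ ?k \<le> N" using floor_log_exp2_le[of N] elim by simp
      have hi: "N < 2 * 2 ^ ?k" using floor_log_exp2_gt[of N] by simp
      have j: "j \<le> 2 ^ ?k" "Suc N = 2 ^ ?k + j" using lo hi by (auto simp: j_def)
      have "(\<Sum>n=1..N. u n) = (\<Sum>n=1..<2 ^ ?k. u n) + (\<Sum>n=2 ^ ?k..<2 ^ ?k + j. u n)"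
        unfolding atLeastLessThanSuc_atLeastAtMost[symmetric] j(2)
        by (subst sum.atLeastLessThan_concat) auto
      then have "(norm ((\<Sum>n=1..N. u n) - (\<Sum>n=1..<2 ^ ?k. u n)))\<^sup>2 \<le> g ?k"
        unfolding g_def using norm_partial_sum_le_dyadic_energy[OF j(1), where u = u and p = "2 ^ ?k"] by simp
      then show ?case by (rule real_le_rsqrt)
    qed
  qed
  from tendsto_add[OF this P] show ?thesis
    by (auto simp: convergent_def)
qed

section \<open>Almost everywhere convergence from second moment bounds\<close>

lemma AE_summable_of_summable_integral:
  fixes g :: "nat \<Rightarrow> 'w \<Rightarrow> real"
  assumes int: "\<And>k. integrable M (g k)" and nonneg: "\<And>k x. g k x \<ge> 0"
    and sum: "summable (\<lambda>k. \<integral>x. g k x \<partial>M)"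
  shows "AE x in M. summable (\<lambda>k. g k x)"
proof -
  have [measurable]: "g k \<in> borel_measurable M" for k using int by auto
  have "(\<integral>\<^sup>+x. (\<Sum>k. ennreal (g k x)) \<partial>M) = (\<Sum>k. \<integral>\<^sup>+x. ennreal (g k x) \<partial>M)"
    by (rule nn_integral_suminf) auto
  also have "\<dots> = (\<Sum>k. ennreal (\<integral>x. g k x \<partial>M))"
    using int nonneg by (subst nn_integral_eq_integral) auto
  also have "\<dots> \<noteq> \<infinity>"
    using sum nonneg by (subst suminf_ennreal2) auto
  finally have "AE x in M. (\<Sum>k. ennreal (g k x)) \<noteq> \<infinity>"
    by (intro nn_integral_noteq_infinite) auto
  then show ?thesis
    by eventually_elim (use nonneg summable_suminf_not_top in auto)
qed

text \<open>
  The dyadic pieces of one length partition the block, so each of the \<open>k + 1\<close> lengths contributes at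
  most \<open>C\<close> times the whole weight of the block.
\<close>

lemma integral_dyadic_energy_le:
  fixes f :: "nat \<Rightarrow> 'w \<Rightarrow> 'a::real_normed_vector"
  assumes int: "\<And>p q. 1 \<le> p \<Longrightarrow> integrable M (\<lambda>x. (norm (\<Sum>i=p..<q. f i x))\<^sup>2)"
    and bound: "\<And>p q. 1 \<le> p \<Longrightarrow>
      (\<integral>x. (norm (\<Sum>i=p..<q. f i x))\<^sup>2 \<partial>M) \<le> C * (\<Sum>i=p..<q. w i)"
    and p: "1 \<le> p"
  shows "integrable M (\<lambda>x. dyadic_energy (\<lambda>i. f i x) k p) \<and>
    (\<integral>x. dyadic_energy (\<lambda>i. f i x) k p \<partial>M) \<le> (real k + 1) * (C * (\<Sum>i=p..<p + 2 ^ k. w i))"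
  using p
proof (induction k arbitrary: p)
  case 0
  then show ?case using int[of p "Suc p"] bound[of p "Suc p"] by simp
next
  case (Suc k)
  let ?W = "\<lambda>p. C * (\<Sum>i=p..<p + 2 ^ k. w i)"
  let ?T = "C * (\<Sum>i=p..<p + 2 ^ Suc k. w i)"
  have halves: "?T = ?W p + ?W (p + 2 ^ k)"
    by (simp add: distrib_left[symmetric] sum.atLeastLessThan_concat mult_2 add.assoc)
  have le: "(real k + 1) * ?W p + (real k + 1) * ?W (p + 2 ^ k) = (real k + 1) * ?T"
    unfolding halves by (simp add: algebra_simps)
  note IH = Suc.IH[of p] Suc.IH[of "p + 2 ^ k"]
  note top = int[OF Suc.prems, of "p + 2 ^ Suc k"] bound[OF Suc.prems, of "p + 2 ^ Suc k"]
  have 1: "integrable M (\<lambda>x. dyadic_energy (\<lambda>i. f i x) k p)"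
    "integrable M (\<lambda>x. dyadic_energy (\<lambda>i. f i x) k (p + 2 ^ k))"
    using IH Suc.prems by auto
  have "(\<integral>x. dyadic_energy (\<lambda>i. f i x) (Suc k) p \<partial>M) =
      (\<integral>x. (norm (\<Sum>i=p..<p + 2 ^ Suc k. f i x))\<^sup>2 \<partial>M) +
      (\<integral>x. dyadic_energy (\<lambda>i. f i x) k p \<partial>M) +
      (\<integral>x. dyadic_energy (\<lambda>i. f i x) k (p + 2 ^ k) \<partial>M)"
    unfolding dyadic_energy.simps using 1 top(1)
    by (subst Bochner_Integration.integral_add; (intro Bochner_Integration.integrable_add)?; simp)+
  also have "\<dots> \<le> ?T + (real k + 1) * ?W p + (real k + 1) * ?W (p + 2 ^ k)"
    using IH top(2) Suc.prems by (intro add_mono) auto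
  also have "\<dots> = (real (Suc k) + 1) * ?T"
    using le by (simp add: algebra_simps)
  finally show ?case
    unfolding dyadic_energy.simps using 1 top(1) by auto
qed

text \<open>
  For \<open>n \<ge> 2\<^sup>k\<close> both \<open>1\<close> and \<open>k\<close> are at most \<open>log\<^sub>2 (n+1)\<close>, so the factor \<open>(k+1)\<^sup>2\<close> of a block is at
  most \<open>4 log\<^sub>2\<^sup>2 (n+1)\<close>.
\<close>

lemma summable_dyadic_blocks_of_log_weight:
  fixes w :: "nat \<Rightarrow> real"
  assumes nonneg: "\<And>n. w n \<ge> 0"
    and sum: "summable (\<lambda>n. w n * (log 2 (real n + 1))\<^sup>2)"
  shows "summable (\<lambda>k. (real k + 1)\<^sup>2 * (\<Sum>i=2 ^ k..<2 ^ k + 2 ^ k. w i))"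
proof (rule summableI_nonneg_bounded)
  let ?v = "\<lambda>n. w n * (log 2 (real n + 1))\<^sup>2"
  show "0 \<le> (real k + 1)\<^sup>2 * (\<Sum>i=2 ^ k..<2 ^ k + 2 ^ k. w i)" for k
    using nonneg by (simp add: sum_nonneg)
  have block: "(real k + 1)\<^sup>2 * (\<Sum>i=2 ^ k..<2 ^ k + 2 ^ k. w i)
      \<le> 4 * (\<Sum>i=2 ^ k..<2 ^ k + 2 ^ k. ?v i)" for k
    unfolding sum_distrib_left
  proof (rule sum_mono)
    fix n :: nat assume "n \<in> {2 ^ k..<2 ^ k + 2 ^ k}"
    then have n: "2 ^ k \<le> n" by simp
    then have n1: "1 \<le> n" by (meson le_trans one_le_numeral one_le_power)
    have "real (2 ^ k) \<le> real n + 1" using of_nat_mono[OF n, where 'a = real] by linarith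
    then have "(2::real) ^ k \<le> real n + 1" by simp
    then have "real k \<le> log 2 (real n + 1)" by (simp add: le_log_iff powr_realpow)
    moreover have "1 \<le> log 2 (real n + 1)" using n1 by (simp add: le_log_iff)
    ultimately have "real k + 1 \<le> 2 * log 2 (real n + 1)" by linarith
    then have "(real k + 1)\<^sup>2 \<le> (2 * log 2 (real n + 1))\<^sup>2" by (intro power_mono) auto
    then have "(real k + 1)\<^sup>2 * w n \<le> (2 * log 2 (real n + 1))\<^sup>2 * w n"
      using nonneg by (rule mult_right_mono)
    then show "(real k + 1)\<^sup>2 * w n \<le> 4 * ?v n" by (simp add: power_mult_distrib mult.commute)
  qed
  show "(\<Sum>k<K. (real k + 1)\<^sup>2 * (\<Sum>i=2 ^ k..<2 ^ k + 2 ^ k. w i)) \<le> 4 * (\<Sum>n. ?v n)" for K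
  proof -
    have "(\<Sum>k<K. (real k + 1)\<^sup>2 * (\<Sum>i=2 ^ k..<2 ^ k + 2 ^ k. w i)) \<le>
        (\<Sum>k<K. 4 * (\<Sum>i=2 ^ k..<2 ^ k + 2 ^ k. ?v i))"
      by (rule sum_mono) (rule block)
    also have "\<dots> = 4 * (\<Sum>i=1..<2 ^ K. ?v i)"
      by (induction K) (simp_all add: distrib_left[symmetric] sum.atLeastLessThan_concat mult_2)
    also have "\<dots> \<le> 4 * (\<Sum>n. ?v n)"
      using nonneg by (intro mult_left_mono sum_le_suminf sum) auto
    finally show ?thesis .
  qed
qed

text \<open>
  The Rademacher--Menshov theorem with orthogonality weakened to a quasi-orthogonality bound on
  sums over intervals.
\<close>

theorem AE_convergent_of_second_moment_bound:
  fixes f :: "nat \<Rightarrow> 'w \<Rightarrow> 'a::banach"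
  assumes int: "\<And>p q. 1 \<le> p \<Longrightarrow> integrable M (\<lambda>x. (norm (\<Sum>i=p..<q. f i x))\<^sup>2)"
    and bound: "\<And>p q. 1 \<le> p \<Longrightarrow>
      (\<integral>x. (norm (\<Sum>i=p..<q. f i x))\<^sup>2 \<partial>M) \<le> C * (\<Sum>i=p..<q. w i)"
    and nonneg: "\<And>n. w n \<ge> 0"
    and sum: "summable (\<lambda>n. w n * (log 2 (real n + 1))\<^sup>2)"
  shows "AE x in M. convergent (\<lambda>N. \<Sum>n=1..N. f n x)"
proof -
  let ?W = "\<lambda>k. \<Sum>i=2 ^ k..<2 ^ k + 2 ^ k. w i"
  have CW: "summable (\<lambda>k. C * ((real k + 1)\<^sup>2 * ?W k))"
    by (intro summable_mult summable_dyadic_blocks_of_log_weight nonneg sum)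
  have "AE x in M. summable (\<lambda>k. (real k + 1)\<^sup>2 * (norm (\<Sum>i=2 ^ k..<2 ^ k + 2 ^ k. f i x))\<^sup>2)"
  proof (rule AE_summable_of_summable_integral)
    show "summable (\<lambda>k. \<integral>x. (real k + 1)\<^sup>2 * (norm (\<Sum>i=2 ^ k..<2 ^ k + 2 ^ k. f i x))\<^sup>2 \<partial>M)"
    proof (rule summable_comparison_test'[OF CW])
      fix k :: nat
      have "(real k + 1)\<^sup>2 * (\<integral>x. (norm (\<Sum>i=2 ^ k..<2 ^ k + 2 ^ k. f i x))\<^sup>2 \<partial>M)
          \<le> (real k + 1)\<^sup>2 * (C * ?W k)"
        by (intro mult_left_mono bound) auto
      then show "norm (\<integral>x. (real k + 1)\<^sup>2 * (norm (\<Sum>i=2 ^ k..<2 ^ k + 2 ^ k. f i x))\<^sup>2 \<partial>M)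
          \<le> C * ((real k + 1)\<^sup>2 * ?W k)"
        by (simp add: mult_ac)
    qed
  qed (auto intro!: int)
  moreover have "AE x in M. summable (\<lambda>k. (real k + 1) * dyadic_energy (\<lambda>i. f i x) k (2 ^ k))"
  proof (rule AE_summable_of_summable_integral)
    note E = integral_dyadic_energy_le[where M = M and f = f and w = w and C = C, OF int bound]
    show "integrable M (\<lambda>x. (real k + 1) * dyadic_energy (\<lambda>i. f i x) k (2 ^ k))" for k
      using E by (intro integrable_mult_right) auto
    show "summable (\<lambda>k. \<integral>x. (real k + 1) * dyadic_energy (\<lambda>i. f i x) k (2 ^ k) \<partial>M)"
    proof (rule summable_comparison_test'[OF CW])
      fix k :: nat
      have "(real k + 1) * (\<integral>x. dyadic_energy (\<lambda>i. f i x) k (2 ^ k) \<partial>M)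
          \<le> (real k + 1) * ((real k + 1) * (C * ?W k))"
        using E[of "2 ^ k" k] by (intro mult_left_mono) auto
      moreover have "(\<integral>x. dyadic_energy (\<lambda>i. f i x) k (2 ^ k) \<partial>M) \<ge> 0"
        by (simp add: dyadic_energy_nonneg)
      ultimately show "norm (\<integral>x. (real k + 1) * dyadic_energy (\<lambda>i. f i x) k (2 ^ k) \<partial>M)
          \<le> C * ((real k + 1)\<^sup>2 * ?W k)"
        by (simp add: mult_ac power2_eq_square)
    qed
  qed (simp add: dyadic_energy_nonneg)
  ultimately show ?thesis
    by eventually_elim (rule convergent_if_dyadic_energy_summable)
qed

section \<open>The second moment bound from the covariance operator\<close>

text \<open>
  Test the operator on the restriction of \<open>x\<close> to \<open>F\<close>, which turns every infinite sum into a finite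
  one, and apply Cauchy--Schwarz.
\<close>

lemma bounded_matrix_op_quadratic_form:
  assumes "bounded_matrix_op I A"
  obtains C where "\<And>F x. finite F \<Longrightarrow> F \<subseteq> I \<Longrightarrow>
    cmod (\<Sum>i\<in>F. \<Sum>j\<in>F. x i * A i j * x j) \<le> C * (\<Sum>i\<in>F. (cmod (x i))\<^sup>2)"
proof -
  from assms obtain C where maps: "\<And>x. x \<in> ell2 I \<Longrightarrow> matrix_op I A x \<in> ell2 I"
    and C: "\<And>x. x \<in> ell2 I \<Longrightarrow> ell2_norm I (matrix_op I A x) \<le> C * ell2_norm I x"
    unfolding bounded_matrix_op_def by blast
  show thesis
  proof (rule that[of C])
    fix F and x :: "'a \<Rightarrow> complex" assume F: "finite F" "F \<subseteq> I"
    define y where "y i = (if i \<in> F then x i else 0)" for i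
    define z where "z = matrix_op I A y"
    have y_sum: "((\<lambda>i. (cmod (y i))\<^sup>2) has_sum (\<Sum>i\<in>F. (cmod (x i))\<^sup>2)) I"
      using has_sum_finite[OF F(1), of "\<lambda>i. (cmod (x i))\<^sup>2"]
      by (rule has_sum_cong_neutral[THEN iffD1, rotated -1]) (use F in \<open>auto simp: y_def\<close>)
    then have y: "y \<in> ell2 I" by (auto simp: ell2_def summable_on_def)
    have ny: "ell2_norm I y = L2_set (\<lambda>i. cmod (x i)) F"
      using y_sum by (simp add: ell2_norm_def L2_set_def infsumI)
    have z_eq: "z i = (\<Sum>j\<in>F. A i j * x j)" for i
    proof -
      have "((\<lambda>j. A i j * y j) has_sum (\<Sum>j\<in>F. A i j * x j)) I"
        using has_sum_finite[OF F(1), of "\<lambda>j. A i j * x j"]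
        by (rule has_sum_cong_neutral[THEN iffD1, rotated -1]) (use F in \<open>auto simp: y_def\<close>)
      then show ?thesis by (simp add: z_def matrix_op_def infsumI)
    qed
    have "L2_set (\<lambda>i. cmod (z i)) F \<le> ell2_norm I z"
      unfolding L2_set_def ell2_norm_def
      using maps[OF y] F by (intro real_sqrt_le_mono finite_sum_le_infsum) (auto simp: ell2_def z_def)
    also have "\<dots> \<le> C * L2_set (\<lambda>i. cmod (x i)) F"
      using C[OF y] by (simp add: z_def ny)
    finally have nz: "L2_set (\<lambda>i. cmod (z i)) F \<le> C * L2_set (\<lambda>i. cmod (x i)) F" .
    have "cmod (\<Sum>i\<in>F. \<Sum>j\<in>F. x i * A i j * x j) = cmod (\<Sum>i\<in>F. x i * z i)"
      by (simp add: z_eq sum_distrib_left mult.assoc)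
    also have "\<dots> \<le> (\<Sum>i\<in>F. \<bar>cmod (x i)\<bar> * \<bar>cmod (z i)\<bar>)"
      by (rule order_trans[OF norm_sum]) (simp add: norm_mult)
    also have "\<dots> \<le> L2_set (\<lambda>i. cmod (x i)) F * L2_set (\<lambda>i. cmod (z i)) F"
      by (rule L2_set_mult_ineq)
    also have "\<dots> \<le> L2_set (\<lambda>i. cmod (x i)) F * (C * L2_set (\<lambda>i. cmod (x i)) F)"
      using nz by (intro mult_left_mono) (auto simp: L2_set_nonneg)
    also have "\<dots> = C * (L2_set (\<lambda>i. cmod (x i)) F)\<^sup>2"
      by (simp add: power2_eq_square)
    also have "\<dots> = C * (\<Sum>i\<in>F. (cmod (x i))\<^sup>2)"
      by (simp add: L2_set_def sum_nonneg)
    finally show "cmod (\<Sum>i\<in>F. \<Sum>j\<in>F. x i * A i j * x j) \<le> C * (\<Sum>i\<in>F. (cmod (x i))\<^sup>2)" .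
  qed
qed

lemma integrable_mult_cnj_of_square_integrable:
  fixes f g :: "'w \<Rightarrow> complex"
  assumes [measurable]: "f \<in> borel_measurable M" "g \<in> borel_measurable M"
    and "integrable M (\<lambda>w. (cmod (f w))\<^sup>2)" "integrable M (\<lambda>w. (cmod (g w))\<^sup>2)"
  shows "integrable M (\<lambda>w. f w * cnj (g w))"
proof (rule Bochner_Integration.integrable_bound)
  show "integrable M (\<lambda>w. (cmod (f w))\<^sup>2 + (cmod (g w))\<^sup>2)"
    using assms by (intro Bochner_Integration.integrable_add)
  have "(\<lambda>w. cnj (g w)) \<in> borel_measurable M"
    by (rule borel_measurable_continuous_on[OF continuous_on_cnj[OF continuous_on_id]]) simp
  then show "(\<lambda>w. f w * cnj (g w)) \<in> borel_measurable M" by measurable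
  show "AE w in M. norm (f w * cnj (g w)) \<le> norm ((cmod (f w))\<^sup>2 + (cmod (g w))\<^sup>2)"
  proof (rule AE_I2)
    fix w
    have "2 * cmod (f w) * cmod (g w) \<le> (cmod (f w))\<^sup>2 + (cmod (g w))\<^sup>2"
      by (rule sum_squares_bound)
    moreover have "0 \<le> cmod (f w) * cmod (g w)" by simp
    ultimately have "cmod (f w) * cmod (g w) \<le> (cmod (f w))\<^sup>2 + (cmod (g w))\<^sup>2"
      by linarith
    then show "norm (f w * cnj (g w)) \<le> norm ((cmod (f w))\<^sup>2 + (cmod (g w))\<^sup>2)"
      by (simp add: norm_mult)
  qed
qed

lemma second_moment_sum_le:
  fixes X :: "nat \<Rightarrow> 'w \<Rightarrow> complex"
  assumes meas: "\<And>n. n \<in> F \<Longrightarrow> X n \<in> borel_measurable M"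
    and sq: "\<And>n. n \<in> F \<Longrightarrow> integrable M (\<lambda>w. (cmod (X n w))\<^sup>2)"
  shows "integrable M (\<lambda>w. (cmod (\<Sum>n\<in>F. a n * X n w))\<^sup>2)"
    and "(\<integral>w. (cmod (\<Sum>n\<in>F. a n * X n w))\<^sup>2 \<partial>M) \<le>
      (\<Sum>n\<in>F. \<Sum>m\<in>F. cmod (a n) * cmod (covariance_matrix M X n m) * cmod (a m))"
proof -
  let ?S = "\<lambda>w. \<Sum>n\<in>F. \<Sum>m\<in>F. a n * cnj (a m) * (X n w * cnj (X m w))"
  have int: "integrable M (\<lambda>w. X n w * cnj (X m w))" if "n \<in> F" "m \<in> F" for n m
    using that meas sq by (intro integrable_mult_cnj_of_square_integrable)
  have expand: "complex_of_real ((cmod (\<Sum>n\<in>F. a n * X n w))\<^sup>2) = ?S w" for w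
    unfolding complex_norm_square by (simp add: sum_product mult_ac)
  have S: "integrable M ?S"
    by (intro Bochner_Integration.integrable_sum integrable_mult_right) (auto intro: int)
  have eq: "(\<lambda>w. (cmod (\<Sum>n\<in>F. a n * X n w))\<^sup>2) = (\<lambda>w. Re (?S w))"
    using expand by (metis Re_complex_of_real)
  show "integrable M (\<lambda>w. (cmod (\<Sum>n\<in>F. a n * X n w))\<^sup>2)"
    unfolding eq using S by (rule integrable_Re)
  have "(\<integral>w. (cmod (\<Sum>n\<in>F. a n * X n w))\<^sup>2 \<partial>M) = Re (\<integral>w. ?S w \<partial>M)"
    unfolding eq using S by (rule integral_Re)
  also have "\<dots> \<le> cmod (\<integral>w. ?S w \<partial>M)"
    by (rule complex_Re_le_cmod)
  also have "(\<integral>w. ?S w \<partial>M) = (\<Sum>n\<in>F. \<Sum>m\<in>F. a n * cnj (a m) * covariance_matrix M X n m)"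
    using int by (simp add: covariance_matrix_def)
  also have "cmod \<dots> \<le>
      (\<Sum>n\<in>F. \<Sum>m\<in>F. cmod (a n) * cmod (covariance_matrix M X n m) * cmod (a m))"
    by (intro order_trans[OF norm_sum] sum_mono) (simp add: norm_mult mult_ac)
  finally show "(\<integral>w. (cmod (\<Sum>n\<in>F. a n * X n w))\<^sup>2 \<partial>M) \<le>
      (\<Sum>n\<in>F. \<Sum>m\<in>F. cmod (a n) * cmod (covariance_matrix M X n m) * cmod (a m))" .
qed

section \<open>Almost sure convergence\<close>

theorem corollary2:
  fixes M :: "'w measure"
    and a :: "nat \<Rightarrow> complex"
    and X :: "nat \<Rightarrow> 'w \<Rightarrow> complex"
    and b :: real
  assumes "prob_space M"
    and "\<And>n. n \<ge> 1 \<Longrightarrow> X n \<in> borel_measurable M"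
    and "\<And>n. n \<ge> 1 \<Longrightarrow> integrable M (\<lambda>w. (cmod (X n w))\<^sup>2)"
    and "b \<ge> 0"
    and "bounded_matrix_op {1..}
           (\<lambda>n m. complex_of_real
              (cmod (covariance_matrix M X n m) * real n powr (- b) * real m powr (- b)))"
    and "(\<lambda>n. (cmod (a n))\<^sup>2 * real n powr (2 * b) * (log 2 (real n + 1))\<^sup>2) summable_on {1..}"
  shows "AE w in M. convergent (\<lambda>N. \<Sum>n=1..N. a n * X n w)"
proof -
  let ?\<gamma> = "covariance_matrix M X"
  let ?w = "\<lambda>n. (cmod (a n))\<^sup>2 * real n powr (2 * b)"
  obtain C where C: "\<And>F x. finite F \<Longrightarrow> F \<subseteq> {1..} \<Longrightarrow>
      cmod (\<Sum>i\<in>F. \<Sum>j\<in>F. x i * complex_of_real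
        (cmod (?\<gamma> i j) * real i powr (- b) * real j powr (- b)) * x j)
      \<le> C * (\<Sum>i\<in>F. (cmod (x i))\<^sup>2)"
    using bounded_matrix_op_quadratic_form[OF assms(5)] by blast
  show ?thesis
  proof (rule AE_convergent_of_second_moment_bound)
    fix p q :: nat assume p: "1 \<le> p"
    let ?F = "{p..<q}"
    show "integrable M (\<lambda>w. (cmod (\<Sum>n=p..<q. a n * X n w))\<^sup>2)"
      using assms(2,3) p by (intro second_moment_sum_le) auto
    define x where "x n = complex_of_real (cmod (a n) * real n powr b)" for n
    \<comment> \<open>The powers of \<open>n\<close> and \<open>m\<close> in \<open>x\<close> cancel those in \<open>\<beta>\<close>.\<close>
    have entry: "x n * complex_of_real (cmod (?\<gamma> n m) * real n powr (- b) * real m powr (- b)) * x m =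
        complex_of_real (cmod (a n) * cmod (?\<gamma> n m) * cmod (a m))" if "n \<in> ?F" "m \<in> ?F" for n m
    proof -
      have "real n powr b \<noteq> 0" "real m powr b \<noteq> 0" using that p by auto
      then show ?thesis unfolding x_def of_real_mult[symmetric] by (simp add: powr_minus field_simps)
    qed
    have "(\<integral>w. (cmod (\<Sum>n=p..<q. a n * X n w))\<^sup>2 \<partial>M) \<le>
        (\<Sum>n\<in>?F. \<Sum>m\<in>?F. cmod (a n) * cmod (?\<gamma> n m) * cmod (a m))"
      using assms(2,3) p by (intro second_moment_sum_le) auto
    also have "\<dots> \<le> cmod (complex_of_real
        (\<Sum>n\<in>?F. \<Sum>m\<in>?F. cmod (a n) * cmod (?\<gamma> n m) * cmod (a m)))"
      unfolding norm_of_real by (rule abs_ge_self)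
    also have "complex_of_real (\<Sum>n\<in>?F. \<Sum>m\<in>?F. cmod (a n) * cmod (?\<gamma> n m) * cmod (a m)) =
        (\<Sum>n\<in>?F. \<Sum>m\<in>?F. x n * complex_of_real
          (cmod (?\<gamma> n m) * real n powr (- b) * real m powr (- b)) * x m)"
      unfolding of_real_sum by (intro sum.cong refl) (metis entry)
    also have "cmod \<dots> \<le> C * (\<Sum>n\<in>?F. (cmod (x n))\<^sup>2)"
      using p by (intro C) auto
    also have "(\<Sum>n\<in>?F. (cmod (x n))\<^sup>2) = (\<Sum>n\<in>?F. ?w n)"
      unfolding mult_2 powr_add by (simp add: x_def norm_mult power2_eq_square mult_ac)
    finally show "(\<integral>w. (cmod (\<Sum>n=p..<q. a n * X n w))\<^sup>2 \<partial>M) \<le> C * (\<Sum>n=p..<q. ?w n)" .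
  next
    show "?w n \<ge> 0" for n by simp
  next
    \<comment> \<open>The index \<open>0\<close> contributes nothing, since \<open>log 2 1 = 0\<close>.\<close>
    have "(\<lambda>n. ?w n * (log 2 (real n + 1))\<^sup>2) summable_on UNIV"
      using assms(6) by (rule summable_on_cong_neutral[THEN iffD1, rotated -1]) auto
    then show "summable (\<lambda>n. ?w n * (log 2 (real n + 1))\<^sup>2)"
      by (rule summable_on_imp_summable)
  qed
qed

end
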